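(* Let $C$ be a general chain of elliptic curves of genus $g$. Given a rectangular Young tableau with $r+1$ columns (numbered $0,\dots,r$) and $g-d+r$ rows, filled with integers among $1,\dots,g$, consider a general point of the component of the Brill-Noether locus on the chain corresponding to the tableau. This point gives rise to a limit linear series. The line bundle $L^1$ on $C$ associated to this limit linear series is described as follows: $$L^1_{|C_i}=\begin{cases}\mathcal O_{C_i} & \text{if } t(i)=r,\\ \mathcal O_{C_i}(x_i),\quad x_i+(r+\beta_{i,t(i)}-t(i)-\beta_{i,r}-1)P_i\equiv (r+\beta_{i,t(i)}-t(i)-\beta_{i,r})Q_i & \text{if } t(i)<r,\\ \mathcal O_{C_i}(x_i),\quad x_i \text{ generic} & \text{if } i \text{ is not in the tableau.}\end{cases}$$
   Context: Here $\equiv$ is linear equivalence on $C_i$. General chain of elliptic curves of genus $g$: elliptic curves $C_1,\dots,C_g$ with points $P_i,Q_i\in C_i$ such that $P_i-Q_i$ is not a torsion point of $C_i$, and $Q_i$ glued to $P_{i+1}$ for $i=1,\dots,g-1$ to form a node. A limit linear series of degree $d$ and projective dimension $r$ on $C$ is the data, for each $i$, of a line bundle $L_i$ of degree $d$ on $C_i$ and an $(r+1)$-dimensional space $V_i\subseteq H^0(C_i,L_i)$ such that at each node the orders of vanishing $u_0>\dots>u_r$ of $V_i$ at $Q_i$ and $u'_0>\dots>u'_r$ of $V_{i+1}$ at $P_{i+1}$ satisfy $u_t+u'_{r-t}\ge d$ for all $t$. The Brill-Noether locus is the image in the Jacobian of the space of limit linear series of degree $d$ and dimension $r$; its components correspond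 to the fillings of the $(r+1)\times(g-d+r)$ rectangle with distinct integers among $1,\dots,g$, strictly increasing along rows and columns. Notation for a tableau: if $i$ appears in the tableau, $t(i)$ denotes its column; $\beta_{i,t}$ is the number of entries $j\le i$ of the tableau in column $t$ (so $i$ lies in row $\beta_{i,t(i)}$). Limit linear series at a general point of the component corresponding to the tableau: if $i$ is not in the tableau, $L_i$ is a general line bundle of degree $d$ on $C_i$; if $i$ is in the tableau, $L_i=\mathcal O((t(i)+i-\beta_{i,t(i)})P_i+(d-t(i)-i+\beta_{i,t(i)})Q_i)$. The orders of vanishing of $V_i$ at $Q_i$ are $u_s(i)=d-s-i+\beta_{i,s}$, $s=0,\dots,r$; the orders of vanishing of $V_i$ at $P_i$ are the numbers $d-u_s(i-1)$, $s=0,\dots,r$, where $u_s(0)=d-s$. The line bundle $L^1$: it is the line bundle on $C$ obtained by gluing the line bundles $L_{i,1}$ on $C_i$, where $L_{1,1}=L_1(-u_r(1)Q_1)$ and, for $i>1$, $L_{i,1}=L_i(-v_0(i)P_i-u_r(i)Q_i)$, with $v_0(i)=d-u_r(i-1)$ the largest order of vanishing of $V_i$ at $P_i$ and $u_r(i)$ the smallest order of vanishing of $V_i$ at $Q_i$ (for $i=g$, $u_r(g)=0$).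
   Formalization: For i = 1 the stated formula fails when r > 0, since L_{1,1} = L_1(-u_r(1)Q_1) has degree r+1; the formal version instead describes the restriction of L^1 to C_1 as O(rP_1 + x_1) (or O(rP_1) if t(1) = r), with x_1 as stated; for i > 1 it is literal. *)

theory Defs
  imports "HOL-Algebra.Algebra" "HOL-Library.Poly_Mapping"
begin

text \<open>
  A smooth projective curve over an algebraically closed field \<open>k\<close> is given by its function
  field, a finitely generated extension of \<open>k\<close> of transcendence degree one. Its points are the
  normalised discrete valuations of the function field that are trivial on \<open>k\<close>; a point is thus
  itself the function "order of vanishing at the point". Function fields are carrier based, so that
  the components of a chain may have non-isomorphic function fields.
\<close>

record ('a, 'f) curve =
  func :: "'f ring"
  const_emb :: "'a \<Rightarrow> 'f"

type_synonym 'f point = "'f \<Rightarrow> int"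
type_synonym 'f divisor = "'f point \<Rightarrow>\<^sub>0 int"

definition consts_of :: "'a ring \<Rightarrow> ('a, 'f) curve \<Rightarrow> 'f set" where
  "consts_of k Y = const_emb Y ` carrier k"

definition nonzero :: "('a, 'f) curve \<Rightarrow> 'f set" where
  "nonzero Y = carrier (func Y) - {\<zero>\<^bsub>func Y\<^esub>}"

definition smooth_projective_curve :: "'a ring \<Rightarrow> ('a, 'f) curve \<Rightarrow> bool" where
  "smooth_projective_curve k Y \<longleftrightarrow>
     algebraically_closed k \<and> field (func Y) \<and> const_emb Y \<in> ring_hom k (func Y) \<and>
     (\<exists>x \<in> carrier (func Y).
        (ring.transcendental (func Y) over consts_of k Y) x \<and>
        ring.finite_dimension (func Y)
          (generate_field (func Y) (insert x (consts_of k Y))) (carrier (func Y)))"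

definition points :: "'a ring \<Rightarrow> ('a, 'f) curve \<Rightarrow> 'f point set" where
  "points k Y = {v. v \<in> extensional (nonzero Y) \<and>
     (\<forall>f \<in> nonzero Y. \<forall>h \<in> nonzero Y. v (f \<otimes>\<^bsub>func Y\<^esub> h) = v f + v h) \<and>
     (\<forall>f \<in> nonzero Y. \<forall>h \<in> nonzero Y.
        f \<oplus>\<^bsub>func Y\<^esub> h \<noteq> \<zero>\<^bsub>func Y\<^esub> \<longrightarrow> min (v f) (v h) \<le> v (f \<oplus>\<^bsub>func Y\<^esub> h)) \<and>
     (\<forall>c \<in> consts_of k Y \<inter> nonzero Y. v c = 0) \<and>
     v ` nonzero Y = UNIV}"

text \<open>
  Line bundles on a curve are represented by divisors, \<open>D\<close> standing for \<open>\<O>(D)\<close>; isomorphism of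
  line bundles is linear equivalence.
\<close>

definition divisors :: "'a ring \<Rightarrow> ('a, 'f) curve \<Rightarrow> 'f divisor set" where
  "divisors k Y = {D. Poly_Mapping.keys D \<subseteq> points k Y}"

definition div_degree :: "'f divisor \<Rightarrow> int" where
  "div_degree D = (\<Sum>p \<in> Poly_Mapping.keys D. Poly_Mapping.lookup D p)"

definition lin_equiv :: "'a ring \<Rightarrow> ('a, 'f) curve \<Rightarrow> 'f divisor \<Rightarrow> 'f divisor \<Rightarrow> bool" where
  "lin_equiv k Y D E \<longleftrightarrow>
     (\<exists>f \<in> nonzero Y. \<forall>p \<in> points k Y. Poly_Mapping.lookup D p - Poly_Mapping.lookup E p = p f)"

definition sections :: "'a ring \<Rightarrow> ('a, 'f) curve \<Rightarrow> 'f divisor \<Rightarrow> 'f set" where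
  "sections k Y D =
     insert \<zero>\<^bsub>func Y\<^esub> {f \<in> nonzero Y. \<forall>p \<in> points k Y. 0 \<le> p f + Poly_Mapping.lookup D p}"

text \<open>
  The genus in the sense of Riemann's theorem: the maximum of \<open>deg D + 1 - dim H\<^sup>0(\<O>(D))\<close> over all
  divisors \<open>D\<close>. Finiteness of the dimensions is spelled out because \<^const>\<open>ring.dim\<close> is only
  meaningful for spaces of finite dimension.
\<close>

definition has_genus :: "'a ring \<Rightarrow> ('a, 'f) curve \<Rightarrow> int \<Rightarrow> bool" where
  "has_genus k Y \<gamma> \<longleftrightarrow>
     (\<forall>D \<in> divisors k Y. ring.finite_dimension (func Y) (consts_of k Y) (sections k Y D)) \<and>
     (\<forall>D \<in> divisors k Y.
        div_degree D + 1 - int (ring.dim (func Y) (consts_of k Y) (sections k Y D)) \<le> \<gamma>) \<and>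
     (\<exists>D \<in> divisors k Y.
        div_degree D + 1 - int (ring.dim (func Y) (consts_of k Y) (sections k Y D)) = \<gamma>)"

definition elliptic_curve :: "'a ring \<Rightarrow> ('a, 'f) curve \<Rightarrow> bool" where
  "elliptic_curve k Y \<longleftrightarrow> smooth_projective_curve k Y \<and> has_genus k Y 1"

text \<open>
  Chains of curves: the point \<open>ptQ C i\<close> of the \<open>i\<close>-th component is glued to the point
  \<open>ptP C (i + 1)\<close> of the next one. Only the indices \<open>1, \<dots>, g\<close> are relevant.
\<close>

record ('a, 'f) chain =
  cpt :: "nat \<Rightarrow> ('a, 'f) curve"
  ptP :: "nat \<Rightarrow> 'f point"
  ptQ :: "nat \<Rightarrow> 'f point"

definition general_elliptic_chain :: "'a ring \<Rightarrow> nat \<Rightarrow> ('a, 'f) chain \<Rightarrow> bool" where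
  "general_elliptic_chain k g C \<longleftrightarrow> 1 \<le> g \<and>
     (\<forall>i \<in> {1..g}. elliptic_curve k (cpt C i) \<and>
        ptP C i \<in> points k (cpt C i) \<and> ptQ C i \<in> points k (cpt C i) \<and>
        (\<forall>n::nat. 0 < n \<longrightarrow> \<not> lin_equiv k (cpt C i)
            (Poly_Mapping.single (ptP C i) (int n)) (Poly_Mapping.single (ptQ C i) (int n))))"

text \<open>
  A line bundle on a chain consists of its restrictions to the components together with an
  identification of the two fibres at each node. The fibre of \<open>\<O>(D)\<close> at \<open>p\<close> is the
  one-dimensional space of functions of order at least \<open>-D(p)\<close> at \<open>p\<close>, modulo those of larger
  order. The identification at the node formed by \<open>ptQ C i\<close> and \<open>ptP C (i + 1)\<close> is the one
  matching the classes of \<open>genQ i\<close> and \<open>genP (i + 1)\<close>, which generate the two fibres.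
\<close>

record 'f chain_bundle =
  restr :: "nat \<Rightarrow> 'f divisor"
  genP :: "nat \<Rightarrow> 'f"
  genQ :: "nat \<Rightarrow> 'f"

definition generates_fibre :: "('a, 'f) curve \<Rightarrow> 'f divisor \<Rightarrow> 'f point \<Rightarrow> 'f \<Rightarrow> bool" where
  "generates_fibre Y D p s \<longleftrightarrow> s \<in> nonzero Y \<and> p s = - Poly_Mapping.lookup D p"

definition line_bundle_on_chain ::
  "'a ring \<Rightarrow> nat \<Rightarrow> ('a, 'f) chain \<Rightarrow> 'f chain_bundle \<Rightarrow> bool" where
  "line_bundle_on_chain k g C M \<longleftrightarrow>
     (\<forall>i \<in> {1..g}. restr M i \<in> divisors k (cpt C i)) \<and>
     (\<forall>i \<in> {1..<g}. generates_fibre (cpt C i) (restr M i) (ptQ C i) (genQ M i) \<and>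
        generates_fibre (cpt C (i + 1)) (restr M (i + 1)) (ptP C (i + 1)) (genP M (i + 1)))"

text \<open>
  A function \<open>f\<close> regarded as a section of \<open>\<O>(D)\<close> vanishes at \<open>p\<close> to order \<open>p f + D(p)\<close>.
\<close>

definition van_orders ::
  "('a, 'f) curve \<Rightarrow> 'f divisor \<Rightarrow> 'f set \<Rightarrow> 'f point \<Rightarrow> int set" where
  "van_orders Y D V p = (\<lambda>f. p f + Poly_Mapping.lookup D p) ` (V \<inter> nonzero Y)"

definition van_order ::
  "('a, 'f) curve \<Rightarrow> 'f divisor \<Rightarrow> 'f set \<Rightarrow> 'f point \<Rightarrow> nat \<Rightarrow> int" where
  "van_order Y D V p t = rev (sorted_list_of_set (van_orders Y D V p)) ! t"

definition limit_linear_series ::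
  "'a ring \<Rightarrow> nat \<Rightarrow> nat \<Rightarrow> nat \<Rightarrow> ('a, 'f) chain \<Rightarrow> (nat \<Rightarrow> 'f divisor) \<Rightarrow> (nat \<Rightarrow> 'f set) \<Rightarrow> bool"
  where
  "limit_linear_series k g d r C L V \<longleftrightarrow>
     (\<forall>i \<in> {1..g}. L i \<in> divisors k (cpt C i) \<and> div_degree (L i) = int d \<and>
        V i \<subseteq> sections k (cpt C i) (L i) \<and>
        subalgebra (consts_of k (cpt C i)) (V i) (func (cpt C i)) \<and>
        ring.dimension (func (cpt C i)) (r + 1) (consts_of k (cpt C i)) (V i)) \<and>
     (\<forall>i \<in> {1..<g}. \<forall>t \<le> r.
        van_order (cpt C i) (L i) (V i) (ptQ C i) t +
        van_order (cpt C (i + 1)) (L (i + 1)) (V (i + 1)) (ptP C (i + 1)) (r - t) \<ge> int d)"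

text \<open>
  Fillings \<open>T\<close> of the rectangle with rows \<open>1, \<dots>, \<rho>\<close> and columns \<open>0, \<dots>, r\<close>; the entry in row \<open>j\<close>
  and column \<open>t\<close> is \<open>T j t\<close>.
\<close>

definition rect_tableau :: "nat \<Rightarrow> nat \<Rightarrow> nat \<Rightarrow> (nat \<Rightarrow> nat \<Rightarrow> nat) \<Rightarrow> bool" where
  "rect_tableau \<rho> r g T \<longleftrightarrow>
     (\<forall>j \<in> {1..\<rho>}. \<forall>t \<le> r. T j t \<in> {1..g}) \<and>
     inj_on (\<lambda>(j, t). T j t) ({1..\<rho>} \<times> {0..r}) \<and>
     (\<forall>j \<in> {1..\<rho>}. \<forall>s t. s < t \<and> t \<le> r \<longrightarrow> T j s < T j t) \<and>
     (\<forall>j \<in> {1..\<rho>}. \<forall>j' \<in> {1..\<rho>}. \<forall>t \<le> r. j < j' \<longrightarrow> T j t < T j' t)"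

definition entries :: "nat \<Rightarrow> nat \<Rightarrow> (nat \<Rightarrow> nat \<Rightarrow> nat) \<Rightarrow> nat set" where
  "entries \<rho> r T = (\<lambda>(j, t). T j t) ` ({1..\<rho>} \<times> {0..r})"

definition col :: "nat \<Rightarrow> nat \<Rightarrow> (nat \<Rightarrow> nat \<Rightarrow> nat) \<Rightarrow> nat \<Rightarrow> nat" where
  "col \<rho> r T i = (THE t. t \<le> r \<and> (\<exists>j \<in> {1..\<rho>}. T j t = i))"

definition beta :: "nat \<Rightarrow> (nat \<Rightarrow> nat \<Rightarrow> nat) \<Rightarrow> nat \<Rightarrow> nat \<Rightarrow> int" where
  "beta \<rho> T i t = int (card {j \<in> {1..\<rho>}. T j t \<le> i})"

text \<open>The numbers \<open>u\<^sub>s(i)\<close>; since no entry is \<open>\<le> 0\<close>, the formula also gives \<open>u\<^sub>s(0) = d - s\<close>.\<close>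

definition tab_u :: "nat \<Rightarrow> nat \<Rightarrow> (nat \<Rightarrow> nat \<Rightarrow> nat) \<Rightarrow> nat \<Rightarrow> nat \<Rightarrow> int" where
  "tab_u d \<rho> T s i = int d - int s - int i + beta \<rho> T i s"

text \<open>
  The limit linear series on the component of the Brill--Noether locus given by the tableau \<open>T\<close>.
  The bundles \<open>L i\<close> with \<open>i\<close> not in the tableau are the free parameters of the component.
\<close>

definition tableau_series ::
  "'a ring \<Rightarrow> nat \<Rightarrow> nat \<Rightarrow> nat \<Rightarrow> ('a, 'f) chain \<Rightarrow> (nat \<Rightarrow> nat \<Rightarrow> nat) \<Rightarrow>
   (nat \<Rightarrow> 'f divisor) \<Rightarrow> (nat \<Rightarrow> 'f set) \<Rightarrow> bool" where
  "tableau_series k g d r C T L V \<longleftrightarrow>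
     (let \<rho> = g + r - d in
     limit_linear_series k g d r C L V \<and>
     (\<forall>i \<in> {1..g} \<inter> entries \<rho> r T.
        let t = col \<rho> r T i; a = int t + int i - beta \<rho> T i t in
        lin_equiv k (cpt C i) (L i)
          (Poly_Mapping.single (ptP C i) a + Poly_Mapping.single (ptQ C i) (int d - a))) \<and>
     (\<forall>i \<in> {1..g}.
        van_orders (cpt C i) (L i) (V i) (ptQ C i) = (\<lambda>s. tab_u d \<rho> T s i) ` {0..r} \<and>
        van_orders (cpt C i) (L i) (V i) (ptP C i) = (\<lambda>s. int d - tab_u d \<rho> T s (i - 1)) ` {0..r}))"

definition L1_cpt ::
  "nat \<Rightarrow> ('a, 'f) chain \<Rightarrow> (nat \<Rightarrow> 'f divisor) \<Rightarrow> (nat \<Rightarrow> 'f set) \<Rightarrow> nat \<Rightarrow> 'f divisor" where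
  "L1_cpt r C L V i =
     (let v0 = van_order (cpt C i) (L i) (V i) (ptP C i) 0;
          ur = van_order (cpt C i) (L i) (V i) (ptQ C i) r in
      if i = 1 then L i - Poly_Mapping.single (ptQ C i) ur
      else L i - Poly_Mapping.single (ptP C i) v0 - Poly_Mapping.single (ptQ C i) ur)"

definition is_L1 ::
  "'a ring \<Rightarrow> nat \<Rightarrow> nat \<Rightarrow> ('a, 'f) chain \<Rightarrow> (nat \<Rightarrow> 'f divisor) \<Rightarrow> (nat \<Rightarrow> 'f set) \<Rightarrow>
   'f chain_bundle \<Rightarrow> bool" where
  "is_L1 k g r C L V M \<longleftrightarrow> line_bundle_on_chain k g C M \<and>
     (\<forall>i \<in> {1..g}. lin_equiv k (cpt C i) (restr M i) (L1_cpt r C L V i))"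

text \<open>
  The proper closed subsets of a curve, and of its one-dimensional \<open>Pic\<^sup>d\<close> in genus one, are the
  finite ones. A family of line bundles is general, relative to finite sets \<open>B i\<close> of excluded
  isomorphism classes, if it avoids these classes.
\<close>

definition avoids ::
  "'a ring \<Rightarrow> ('a, 'f) chain \<Rightarrow> nat set \<Rightarrow> (nat \<Rightarrow> 'f divisor set) \<Rightarrow> (nat \<Rightarrow> 'f divisor) \<Rightarrow> bool" where
  "avoids k C I B L \<longleftrightarrow> (\<forall>i \<in> I. \<forall>E \<in> B i. \<not> lin_equiv k (cpt C i) (L i) E)"

text \<open>
  As \<open>L\<^sup>1\<close> is not twisted down at the first marked point of the first component, its restriction
  there has the additional fixed part \<open>r P\<^sub>1\<close>, without which the total degree would not be \<open>d\<close>.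
\<close>

definition fixed_part :: "nat \<Rightarrow> ('a, 'f) chain \<Rightarrow> nat \<Rightarrow> 'f divisor" where
  "fixed_part r C i = (if i = 1 then Poly_Mapping.single (ptP C 1) (int r) else 0)"

end

theory Submission
  imports Defs
begin

text \<open>
  On every component, \<open>L\<^sup>1\<close> is the restriction of \<open>L\<close> twisted down by numbers that are read off the
  tableau, so up to the fixed part it is \<open>\<O>\<close>, \<open>\<O>((1 - m) P + m Q)\<close> or a bundle of degree one in
  general position. What remains is that a divisor \<open>D\<close> of degree one on a curve of genus one is
  equivalent to a point. Riemann's inequality gives a nonzero section \<open>f\<close> of \<open>\<O>(D)\<close>. If a divisor
  \<open>E\<close> of negative degree had a nonzero section \<open>h\<close>, multiplication by \<open>h\<^sup>n\<close> would embed
  \<open>H\<^sup>0(\<O>(-n E))\<close>, of dimension at least \<open>n\<close>, into \<open>H\<^sup>0(\<O>)\<close> for all \<open>n\<close>; hence the effective divisor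
  \<open>D + div f\<close> consists of a single point.
\<close>

section \<open>Divisors\<close>

text \<open>Divisors with different supports are compared by summing over one common finite
  set.\<close>

lemma div_degree_eq_sum:
  assumes "finite A" "Poly_Mapping.keys D \<subseteq> A"
  shows "div_degree D = (\<Sum>p\<in>A. Poly_Mapping.lookup D p)"
  unfolding div_degree_def
  by (rule sum.mono_neutral_left) (use assms in \<open>auto simp: in_keys_iff\<close>)

lemma div_degree_zero [simp]: "div_degree 0 = 0"
  by (simp add: div_degree_def)

lemma div_degree_single [simp]: "div_degree (Poly_Mapping.single p n) = n"
  by (simp add: div_degree_eq_sum[of "{p}"])

lemma div_degree_add: "div_degree (D + E) = div_degree D + div_degree E"
proof -
  let ?A = "Poly_Mapping.keys D \<union> Poly_Mapping.keys E"
  have "Poly_Mapping.keys (D + E) \<subseteq> ?A" by (rule keys_add)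
  then show ?thesis
    by (simp add: div_degree_eq_sum[of ?A] lookup_add sum.distrib)
qed

lemma div_degree_uminus: "div_degree (- D) = - div_degree D"
  by (simp add: div_degree_def sum_negf)

lemma div_degree_diff: "div_degree (D - E) = div_degree D - div_degree E"
  using div_degree_add[of D "- E"] by (simp add: div_degree_uminus)

lemma divisors_zero [simp]: "0 \<in> divisors k Y"
  by (simp add: divisors_def)

lemma divisors_single [intro]: "p \<in> points k Y \<Longrightarrow> Poly_Mapping.single p n \<in> divisors k Y"
  by (simp add: divisors_def)

lemma divisors_add [intro]:
  "D \<in> divisors k Y \<Longrightarrow> E \<in> divisors k Y \<Longrightarrow> D + E \<in> divisors k Y"
  using keys_add[of D E] by (auto simp: divisors_def)

lemma divisors_diff [intro]:
  "D \<in> divisors k Y \<Longrightarrow> E \<in> divisors k Y \<Longrightarrow> D - E \<in> divisors k Y"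
  using keys_diff[of D E] by (auto simp: divisors_def)

section \<open>Linear equivalence and sections\<close>

lemma lin_equiv_iff_diff:
  "lin_equiv k Y D E \<longleftrightarrow> lin_equiv k Y (D - E) 0"
  by (simp add: lin_equiv_def lookup_minus)

text \<open>Moving terms across a linear equivalence thus becomes an identity in the group of
  divisors, with no function to exhibit.\<close>

lemma lin_equiv_cong_diff:
  assumes "lin_equiv k Y D E" "D' - E' = D - E"
  shows "lin_equiv k Y D' E'"
  using assms lin_equiv_iff_diff[of k Y D E] lin_equiv_iff_diff[of k Y D' E'] by simp

locale curve =
  fixes k :: "'a ring" and Y :: "('a, 'f) curve"
  assumes smooth: "smooth_projective_curve k Y"
begin

sublocale F: field "func Y"
  using smooth by (simp add: smooth_projective_curve_def)

text \<open>A homomorphism from a field to a ring with \<open>1\<close> different from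
  \<open>0\<close> has a field as image; this provides the scalars for the spaces of
  sections.\<close>

lemma consts_subfield: "subfield (consts_of k Y) (func Y)"
proof -
  interpret k: field k
    using smooth by (simp add: smooth_projective_curve_def algebraically_closed_def)
  interpret ring_hom_ring k "func Y" "const_emb Y"
    using smooth k.ring_axioms F.ring_axioms
    by (intro ring_hom_ringI2) (auto simp: smooth_projective_curve_def)
  show ?thesis
    unfolding consts_of_def
    using img_is_subfield(2)[OF k.carrier_is_subfield] F.one_not_zero by auto
qed

lemma one_nonzero: "\<one>\<^bsub>func Y\<^esub> \<in> nonzero Y"
  by (simp add: nonzero_def)

lemma mult_nonzero: "f \<in> nonzero Y \<Longrightarrow> h \<in> nonzero Y \<Longrightarrow> f \<otimes>\<^bsub>func Y\<^esub> h \<in> nonzero Y"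
  by (auto simp: nonzero_def F.integral_iff)

lemma inv_nonzero: "f \<in> nonzero Y \<Longrightarrow> inv\<^bsub>func Y\<^esub> f \<in> nonzero Y"
  using F.Units_inv_Units[of f] by (simp add: nonzero_def F.field_Units)

lemma point_mult:
  "p \<in> points k Y \<Longrightarrow> f \<in> nonzero Y \<Longrightarrow> h \<in> nonzero Y \<Longrightarrow> p (f \<otimes>\<^bsub>func Y\<^esub> h) = p f + p h"
  by (simp add: points_def)

lemma point_one: "p \<in> points k Y \<Longrightarrow> p \<one>\<^bsub>func Y\<^esub> = 0"
  using point_mult[OF _ one_nonzero one_nonzero, of p] by simp

lemma point_inv: "p \<in> points k Y \<Longrightarrow> f \<in> nonzero Y \<Longrightarrow> p (inv\<^bsub>func Y\<^esub> f) = - p f"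
  using point_mult[OF _ _ inv_nonzero, of p f f] point_one[of p]
  by (simp add: nonzero_def F.field_Units)

lemma lin_equiv_sym: "lin_equiv k Y D E \<Longrightarrow> lin_equiv k Y E D"
proof -
  assume "lin_equiv k Y D E"
  then obtain f where f: "f \<in> nonzero Y"
      "\<And>p. p \<in> points k Y \<Longrightarrow> Poly_Mapping.lookup D p - Poly_Mapping.lookup E p = p f"
    unfolding lin_equiv_def by blast
  have "Poly_Mapping.lookup E p - Poly_Mapping.lookup D p = p (inv\<^bsub>func Y\<^esub> f)"
    if "p \<in> points k Y" for p
    using f(2)[OF that] point_inv[OF that f(1)] by linarith
  then show "lin_equiv k Y E D"
    unfolding lin_equiv_def using inv_nonzero[OF f(1)] by blast
qed

lemma lin_equiv_trans [trans]:
  assumes "lin_equiv k Y D E" "lin_equiv k Y E G"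
  shows "lin_equiv k Y D G"
proof -
  obtain f h where f: "f \<in> nonzero Y"
      "\<And>p. p \<in> points k Y \<Longrightarrow> Poly_Mapping.lookup D p - Poly_Mapping.lookup E p = p f"
    and h: "h \<in> nonzero Y"
      "\<And>p. p \<in> points k Y \<Longrightarrow> Poly_Mapping.lookup E p - Poly_Mapping.lookup G p = p h"
    using assms unfolding lin_equiv_def by blast
  show ?thesis
    unfolding lin_equiv_def
  proof (intro bexI[of _ "f \<otimes>\<^bsub>func Y\<^esub> h"] ballI)
    fix p assume p: "p \<in> points k Y"
    show "Poly_Mapping.lookup D p - Poly_Mapping.lookup G p = p (f \<otimes>\<^bsub>func Y\<^esub> h)"
      using f(2)[OF p] h(2)[OF p] point_mult[OF p f(1) h(1)] by simp
  qed (rule mult_nonzero[OF f(1) h(1)])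
qed

section \<open>Multiplication by a fixed nonzero function\<close>

lemma section_mult:
  assumes "f \<in> nonzero Y" "f \<in> sections k Y D" "h \<in> sections k Y E"
  shows "h \<otimes>\<^bsub>func Y\<^esub> f \<in> sections k Y (D + E)"
proof (cases "h \<in> nonzero Y")
  case True
  have "0 \<le> p (h \<otimes>\<^bsub>func Y\<^esub> f) + Poly_Mapping.lookup (D + E) p" if p: "p \<in> points k Y" for p
  proof -
    have "0 \<le> p f + Poly_Mapping.lookup D p" "0 \<le> p h + Poly_Mapping.lookup E p"
      using assms True p by (auto simp: sections_def nonzero_def)
    then show ?thesis
      using point_mult[OF p True assms(1)] by (simp add: lookup_add)
  qed
  then show ?thesis
    using mult_nonzero[OF True assms(1)] by (simp add: sections_def)
next
  case False
  then show ?thesis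
    using assms by (auto simp: sections_def nonzero_def)
qed

text \<open>The factor \<open>f\<close> comes out of any vanishing combination and can be cancelled,
  as a field has no zero divisors.\<close>

lemma independent_mult_right:
  assumes "ring.independent (func Y) (consts_of k Y) Us" "f \<in> nonzero Y"
  shows "ring.independent (func Y) (consts_of k Y) (map (\<lambda>u. u \<otimes>\<^bsub>func Y\<^esub> f) Us)"
proof -
  have Us: "set Us \<subseteq> carrier (func Y)"
    by (rule F.independent_in_carrier[OF assms(1)])
  have f: "f \<in> carrier (func Y)" "f \<noteq> \<zero>\<^bsub>func Y\<^esub>"
    using assms(2) by (auto simp: nonzero_def)
  show ?thesis
  proof (rule F.trivial_combine_imp_independent[OF consts_subfield])
    show "set (map (\<lambda>u. u \<otimes>\<^bsub>func Y\<^esub> f) Us) \<subseteq> carrier (func Y)"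
      using Us f by auto
    fix Ks assume Ks: "set Ks \<subseteq> consts_of k Y"
      and zero: "F.combine Ks (map (\<lambda>u. u \<otimes>\<^bsub>func Y\<^esub> f) Us) = \<zero>\<^bsub>func Y\<^esub>"
    have Ks': "set Ks \<subseteq> carrier (func Y)"
      using Ks subfieldE(3)[OF consts_subfield] by blast
    have "F.combine Ks Us \<otimes>\<^bsub>func Y\<^esub> f = \<zero>\<^bsub>func Y\<^esub>"
      using zero F.combine_l_distr[OF Ks' Us f(1)] by simp
    then have "F.combine Ks Us = \<zero>\<^bsub>func Y\<^esub>"
      using F.integral_iff[OF F.combine_in_carrier[OF Ks' Us] f(1)] f(2) by simp
    then show "set (take (length (map (\<lambda>u. u \<otimes>\<^bsub>func Y\<^esub> f) Us)) Ks) \<subseteq> {\<zero>\<^bsub>func Y\<^esub>}"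
      using F.independent_imp_trivial_combine[OF consts_subfield assms(1) Ks] by simp
  qed
qed

end

section \<open>Curves of genus one\<close>

locale genus_one_curve =
  fixes k :: "'a ring" and Y :: "('a, 'f) curve"
  assumes elliptic: "elliptic_curve k Y"
begin

sublocale curve
  using elliptic by unfold_locales (simp add: elliptic_curve_def)

abbreviation h0 :: "'f divisor \<Rightarrow> nat" where
  "h0 D \<equiv> F.dim (consts_of k Y) (sections k Y D)"

text \<open>The finiteness clause of \<open>has_genus\<close> is what makes \<open>h0\<close> a
  genuine dimension.\<close>

lemma sections_dimension:
  "D \<in> divisors k Y \<Longrightarrow> F.dimension (h0 D) (consts_of k Y) (sections k Y D)"
  using elliptic F.finite_dimensionE[OF consts_subfield]
  by (simp add: elliptic_curve_def has_genus_def over_def)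

lemma riemann_inequality: "D \<in> divisors k Y \<Longrightarrow> div_degree D \<le> int (h0 D)"
  using elliptic unfolding elliptic_curve_def has_genus_def by force

text \<open>Multiplication by \<open>f\<close> embeds the sections of \<open>E\<close> into those of
  \<open>D + E\<close>; a basis is sent to an independent list.\<close>

lemma h0_le_of_section:
  assumes D: "D \<in> divisors k Y" and E: "E \<in> divisors k Y"
    and f: "f \<in> nonzero Y" "f \<in> sections k Y D"
  shows "h0 E \<le> h0 (D + E)"
proof -
  obtain Us where Us: "set Us \<subseteq> carrier (func Y)" "F.independent (consts_of k Y) Us"
      "length Us = h0 E" "F.Span (consts_of k Y) Us = sections k Y E"
    using F.exists_base[OF consts_subfield sections_dimension[OF E]] by blast
  have "set Us \<subseteq> sections k Y E"
    using F.Span_base_incl[OF consts_subfield Us(1)] Us(4) by simp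
  then have "set (map (\<lambda>u. u \<otimes>\<^bsub>func Y\<^esub> f) Us) \<subseteq> sections k Y (D + E)"
    using section_mult[OF f] by auto
  from F.independent_length_le_dimension[OF consts_subfield sections_dimension
      independent_mult_right[OF Us(2) f(1)] this]
  show ?thesis using D E Us(3) by auto
qed

lemma degree_nonneg_of_section:
  assumes D: "D \<in> divisors k Y" and f: "f \<in> nonzero Y" "f \<in> sections k Y D"
  shows "0 \<le> div_degree D"
proof (rule ccontr)
  assume neg: "\<not> 0 \<le> div_degree D"
  \<comment> \<open>The witnesses are 0, -D, -2D and so on. Subtracting \<open>D\<close> raises the
    degree by at least one, while multiplication by \<open>f\<close> keeps \<open>h0\<close> from
    growing.\<close>
  have "\<exists>A \<in> divisors k Y. int n \<le> div_degree A \<and> h0 A \<le> h0 0" for n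
  proof (induction n)
    case 0
    show ?case by (intro bexI[of _ 0]) auto
  next
    case (Suc n)
    then obtain A where A: "A \<in> divisors k Y" "int n \<le> div_degree A" "h0 A \<le> h0 0"
      by blast
    show ?case
    proof (intro bexI conjI)
      show "A - D \<in> divisors k Y" using A D by auto
      show "int (Suc n) \<le> div_degree (A - D)" using A neg by (simp add: div_degree_diff)
      show "h0 (A - D) \<le> h0 0"
        using h0_le_of_section[OF D \<open>A - D \<in> divisors k Y\<close> f] A(3) by simp
    qed
  qed
  \<comment> \<open>With this index \<open>div_degree A\<close> exceeds \<open>h0 0\<close>, hence
    also \<open>h0 A\<close>, against Riemann's inequality.\<close>
  from this[of "Suc (h0 0)"] riemann_inequality show False by fastforce
qed

lemma degree_one_equiv_point:
  assumes D: "D \<in> divisors k Y" and deg: "div_degree D = 1"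
  obtains x where "x \<in> points k Y" "lin_equiv k Y D (Poly_Mapping.single x 1)"
proof -
  have "sections k Y D \<noteq> {\<zero>\<^bsub>func Y\<^esub>}"
  proof
    assume "sections k Y D = {\<zero>\<^bsub>func Y\<^esub>}"
    then have "h0 D = 0"
      using F.dimension_is_inj[OF consts_subfield sections_dimension[OF D]] F.zero_dim by metis
    then show False using riemann_inequality[OF D] deg by simp
  qed
  then obtain f where f: "f \<in> nonzero Y"
    and eff: "\<And>p. p \<in> points k Y \<Longrightarrow> 0 \<le> p f + Poly_Mapping.lookup D p"
    unfolding sections_def by blast
  \<comment> \<open>Without a positive coefficient in D + div f, the inverse of \<open>f\<close>
    would be a section of \<open>- D\<close>, which has degree -1.\<close>
  have "\<exists>x \<in> points k Y. 0 < x f + Poly_Mapping.lookup D x"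
  proof (rule ccontr)
    assume neg: "\<not> ?thesis"
    have "0 \<le> p (inv\<^bsub>func Y\<^esub> f) + Poly_Mapping.lookup (- D) p" if "p \<in> points k Y" for p
      using neg that point_inv[OF that f] by fastforce
    then have "inv\<^bsub>func Y\<^esub> f \<in> sections k Y (- D)"
      using inv_nonzero[OF f] by (simp add: sections_def)
    moreover have "- D \<in> divisors k Y" using D by (simp add: divisors_def)
    ultimately show False
      using degree_nonneg_of_section[OF _ inv_nonzero[OF f]] deg by (fastforce simp: div_degree_uminus)
  qed
  then obtain x where x: "x \<in> points k Y" "0 < x f + Poly_Mapping.lookup D x" by blast
  \<comment> \<open>After \<open>x\<close> is removed the degree is 0, so one more positive
    coefficient would give a divisor of degree -1 with a section. Allowing \<open>q = x\<close>
    excludes multiplicities.\<close>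
  have zero: "q f + Poly_Mapping.lookup (D - Poly_Mapping.single x 1) q = 0" if q: "q \<in> points k Y" for q
  proof (rule ccontr)
    let ?E = "D - Poly_Mapping.single x 1"
    assume nz: "q f + Poly_Mapping.lookup ?E q \<noteq> 0"
    have E: "0 \<le> p f + Poly_Mapping.lookup ?E p" if "p \<in> points k Y" for p
      using eff[OF that] x(2) by (auto simp: lookup_minus lookup_single when_def)
    have "0 \<le> p f + Poly_Mapping.lookup (?E - Poly_Mapping.single q 1) p"
      if "p \<in> points k Y" for p
      using E[OF that] nz by (cases "p = q") (simp_all add: lookup_minus[of ?E] lookup_single)
    then have "f \<in> sections k Y (?E - Poly_Mapping.single q 1)"
      using f by (simp add: sections_def)
    moreover have "?E - Poly_Mapping.single q 1 \<in> divisors k Y" using D x q by auto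
    ultimately show False
      using degree_nonneg_of_section[OF _ f] deg by (fastforce simp: div_degree_diff)
  qed
  \<comment> \<open>D + div f = x means D - x = -div f, hence the inverse.\<close>
  have "Poly_Mapping.lookup D q - Poly_Mapping.lookup (Poly_Mapping.single x 1) q =
      q (inv\<^bsub>func Y\<^esub> f)" if "q \<in> points k Y" for q
    using zero[OF that] point_inv[OF that f] unfolding lookup_minus by linarith
  then have "lin_equiv k Y D (Poly_Mapping.single x 1)"
    unfolding lin_equiv_def using inv_nonzero[OF f] by blast
  with x(1) show ?thesis by (rule that)
qed

end

section \<open>Tableaux and orders of vanishing\<close>

text \<open>Injectivity of the filling makes the column in the definite description unique.\<close>

lemma col_eq:
  assumes "rect_tableau \<rho> r g T" "j \<in> {1..\<rho>}" "t \<le> r"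
  shows "col \<rho> r T (T j t) = t"
  unfolding col_def
proof (rule the_equality)
  fix s assume "s \<le> r \<and> (\<exists>j'\<in>{1..\<rho>}. T j' s = T j t)"
  then obtain j' where "j' \<in> {1..\<rho>}" "s \<le> r" "T j' s = T j t" by blast
  with assms show "s = t"
    by (auto simp: rect_tableau_def dest: inj_onD[where x = "(j', s)" and y = "(j, t)"])
qed (use assms in auto)

lemma beta_zero:
  assumes "rect_tableau \<rho> r g T" "t \<le> r"
  shows "beta \<rho> T 0 t = 0"
proof -
  have "1 \<le> T j t" if "j \<in> {1..\<rho>}" for j
    using assms that by (simp add: rect_tableau_def)
  then have "{j \<in> {1..\<rho>}. T j t \<le> 0} = {}" by force
  then show ?thesis unfolding beta_def by (simp only: card.empty of_nat_0)
qed

text \<open>Rows increase, so every row counted for column \<open>t\<close> is also counted for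
  column \<open>s\<close>.\<close>

lemma beta_antimono:
  assumes "rect_tableau \<rho> r g T" "s \<le> t" "t \<le> r"
  shows "beta \<rho> T i t \<le> beta \<rho> T i s"
proof (cases "s = t")
  case False
  then have "T j s < T j t" if "j \<in> {1..\<rho>}" for j
    using assms that by (auto simp: rect_tableau_def)
  then show ?thesis
    unfolding beta_def by (intro of_nat_mono card_mono) (auto intro: order.trans less_imp_le)
qed simp

text \<open>From \<open>i - 1\<close> to \<open>i\<close> exactly one row is added to the count, the
  one containing \<open>i\<close>. Hence \<open>tab_u\<close> keeps its value in this
  column.\<close>

lemma beta_pred_entry:
  assumes T: "rect_tableau \<rho> r g T" and i: "i \<in> entries \<rho> r T" "1 \<le> i" and col: "col \<rho> r T i = t"
    and "t \<le> r"
  shows "beta \<rho> T (i - 1) t = beta \<rho> T i t - 1"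
proof -
  obtain j where j: "j \<in> {1..\<rho>}" "T j t = i"
    using i(1) col col_eq[OF T] by (auto simp: entries_def)
  have inj: "j' = j" if "j' \<in> {1..\<rho>}" "T j' t = i" for j'
    using T j that \<open>t \<le> r\<close>
    by (auto simp: rect_tableau_def dest: inj_onD[where x = "(j', t)" and y = "(j, t)"])
  have "{j \<in> {1..\<rho>}. T j t \<le> i} = insert j {j \<in> {1..\<rho>}. T j t \<le> i - 1}"
  proof (intro equalityI subsetI)
    fix j' assume "j' \<in> {j \<in> {1..\<rho>}. T j t \<le> i}"
    then show "j' \<in> insert j {j \<in> {1..\<rho>}. T j t \<le> i - 1}"
      using inj[of j'] \<open>1 \<le> i\<close> by (cases "T j' t = i") auto
  qed (use j in auto)
  moreover have "j \<notin> {j \<in> {1..\<rho>}. T j t \<le> i - 1}"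
    using j \<open>1 \<le> i\<close> by auto
  ultimately show ?thesis
    by (simp add: beta_def)
qed

text \<open>Here no row is added, so \<open>tab_u\<close> drops by one. The premise is an
  implication because \<open>col\<close> is meaningful only for entries; numbers outside the tableau
  are covered as well.\<close>

lemma beta_pred_other:
  assumes T: "rect_tableau \<rho> r g T" and i: "i \<in> entries \<rho> r T \<Longrightarrow> col \<rho> r T i \<noteq> t" and "t \<le> r"
  shows "beta \<rho> T (i - 1) t = beta \<rho> T i t"
proof -
  have "T j t \<noteq> i" if "j \<in> {1..\<rho>}" for j
    using i col_eq[OF T that \<open>t \<le> r\<close>] that \<open>t \<le> r\<close> by (force simp: entries_def)
  then have "{j \<in> {1..\<rho>}. T j t \<le> i - 1} = {j \<in> {1..\<rho>}. T j t \<le> i}"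
    by force
  then show ?thesis by (simp add: beta_def)
qed

section \<open>Orders of vanishing as strictly monotone sequences\<close>

lemma tab_u_strict_antimono:
  assumes "rect_tableau \<rho> r g T" "s < t" "t \<le> r"
  shows "tab_u d \<rho> T t i < tab_u d \<rho> T s i"
  using beta_antimono[OF assms(1), of s t i] assms by (simp add: tab_u_def)

text \<open>A finite set of integers has only one strictly decreasing enumeration, so
  \<open>u\<close> agrees with the one obtained by sorting.\<close>

lemma van_order_eq:
  fixes u :: "nat \<Rightarrow> int"
  assumes orders: "van_orders Y D V p = u ` {0..r}"
    and dec: "\<And>s t. s < t \<Longrightarrow> t \<le> r \<Longrightarrow> u t < u s" and "s \<le> r"
  shows "van_order Y D V p s = u s"
proof -
  let ?xs = "map u [0..<Suc r]"
  have "sorted_wrt (>) ?xs"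
    using dec by (auto simp: sorted_wrt_iff_nth_less nth_append simp del: upt_Suc)
  then have "sorted_wrt (<) (rev ?xs)"
    by (simp add: sorted_wrt_rev del: upt_Suc)
  moreover have "set (rev ?xs) = van_orders Y D V p"
    unfolding orders by (simp only: set_rev set_map set_upt atLeastLessThanSuc_atLeastAtMost)
  ultimately have "sorted_list_of_set (van_orders Y D V p) = rev ?xs"
    by (metis sorted_list_of_set.idem_if_sorted_distinct strict_sorted_iff)
  then show ?thesis
    using \<open>s \<le> r\<close> unfolding van_order_def by (simp add: nth_append del: upt_Suc)
qed

text \<open>Serves the points \<open>ptP C i\<close>, where the orders grow with the column;
  reversing the index reduces this to the decreasing case.\<close>

lemma van_order_top_eq:
  fixes v :: "nat \<Rightarrow> int"
  assumes "van_orders Y D V p = v ` {0..r}"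
    and "\<And>s t. s < t \<Longrightarrow> t \<le> r \<Longrightarrow> v s < v t"
  shows "van_order Y D V p 0 = v r"
proof -
  have "v ` {0..r} = (\<lambda>s. v (r - s)) ` {0..r}"
  proof (intro equalityI subsetI)
    fix y assume "y \<in> v ` {0..r}"
    then obtain s where "s \<le> r" "y = v s" by auto
    then show "y \<in> (\<lambda>s. v (r - s)) ` {0..r}"
      by (intro image_eqI[of _ _ "r - s"]) auto
  qed auto
  with assms show ?thesis
    using van_order_eq[of Y D V p "\<lambda>s. v (r - s)" r 0] by simp
qed

text \<open>The divisor by which \<open>L\<^sup>1\<close> differs from \<open>L\<close> on the \<open>i\<close>-th component, up to the fixed part.\<close>

definition tab_twist ::
  "nat \<Rightarrow> nat \<Rightarrow> nat \<Rightarrow> ('a, 'f) chain \<Rightarrow> (nat \<Rightarrow> nat \<Rightarrow> nat) \<Rightarrow> nat \<Rightarrow> 'f divisor" where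
  "tab_twist d \<rho> r C T i = Poly_Mapping.single (ptP C i) (int d - tab_u d \<rho> T r (i - 1)) +
     Poly_Mapping.single (ptQ C i) (tab_u d \<rho> T r i)"

text \<open>For \<open>i = 1\<close> the divisor \<open>L1_cpt\<close> is not twisted at the first
  marked point, whereas \<open>tab_twist\<close> has the coefficient d - u_r(0) = r there;
  \<open>fixed_part\<close> makes up for it.\<close>

lemma L1_cpt_eq:
  assumes T: "rect_tableau (g + r - d) r g T" and series: "tableau_series k g d r C T L V"
    and i: "i \<in> {1..g}"
  shows "L1_cpt r C L V i = L i - tab_twist d (g + r - d) r C T i + fixed_part r C i"
proof -
  let ?u = "tab_u d (g + r - d) T"
  have orders:
    "van_orders (cpt C i) (L i) (V i) (ptQ C i) = (\<lambda>s. ?u s i) ` {0..r}"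
    "van_orders (cpt C i) (L i) (V i) (ptP C i) = (\<lambda>s. int d - ?u s (i - 1)) ` {0..r}"
    using series i by (auto simp: tableau_series_def Let_def)
  have Q: "van_order (cpt C i) (L i) (V i) (ptQ C i) r = ?u r i"
    using tab_u_strict_antimono[OF T] by (intro van_order_eq[OF orders(1)]) auto
  have P: "van_order (cpt C i) (L i) (V i) (ptP C i) 0 = int d - ?u r (i - 1)"
    using tab_u_strict_antimono[OF T] by (intro van_order_top_eq[OF orders(2)]) auto
  have "int d - ?u r 0 = int r"
    using beta_zero[OF T, of r] by (simp add: tab_u_def)
  then show ?thesis
    by (auto simp: L1_cpt_def Let_def P Q fixed_part_def tab_twist_def)
qed

section \<open>The restrictions of \<open>L\<^sup>1\<close>\<close>

text \<open>Genericity of the point is expressed through finite sets: whatever \<open>Z\<close> is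
  to be avoided, excluding finitely many classes of \<open>L i\<close> suffices. The sets
  \<open>B\<close> are chosen before \<open>L\<close>, \<open>V\<close> and
  \<open>M\<close>.\<close>

theorem lemma3p4:
  fixes k :: "'a ring" and C :: "('a, 'f) chain" and g d r \<rho> :: nat
    and T :: "nat \<Rightarrow> nat \<Rightarrow> nat" and Z :: "nat \<Rightarrow> 'f point set"
  assumes chain: "general_elliptic_chain k g C"
    and rows: "d \<le> g + r" "\<rho> = g + r - d"
    and tableau: "rect_tableau \<rho> r g T"
    and closed: "\<And>i. finite (Z i)"
  shows "\<exists>B. (\<forall>i. finite (B i)) \<and>
    (\<forall>L V M.
      tableau_series k g d r C T L V \<longrightarrow>
      avoids k C ({1..g} - entries \<rho> r T) B L \<longrightarrow>
      is_L1 k g r C L V M \<longrightarrow>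
      (\<forall>i \<in> {1..g}.
        let Y = cpt C i; P = ptP C i; Q = ptQ C i; t = col \<rho> r T i;
            m = int r + beta \<rho> T i t - int t - beta \<rho> T i r in
        (i \<in> entries \<rho> r T \<and> t = r \<longrightarrow>
           lin_equiv k Y (restr M i) (fixed_part r C i)) \<and>
        (i \<in> entries \<rho> r T \<and> t < r \<longrightarrow>
           (\<exists>x \<in> points k Y.
              lin_equiv k Y (restr M i) (fixed_part r C i + Poly_Mapping.single x 1) \<and>
              lin_equiv k Y (Poly_Mapping.single x 1 + Poly_Mapping.single P (m - 1))
                (Poly_Mapping.single Q m))) \<and>
        (i \<notin> entries \<rho> r T \<longrightarrow>
           (\<exists>x \<in> points k Y - Z i.
              lin_equiv k Y (restr M i) (fixed_part r C i + Poly_Mapping.single x 1)))))"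
proof -
  let ?W = "tab_twist d \<rho> r C T"
  \<comment> \<open>These are the classes that twisting down by \<open>?W i\<close> turns into a
    point of \<open>Z i\<close>.\<close>
  define B where "B i = (\<lambda>x. Poly_Mapping.single x 1 + ?W i) ` Z i" for i
  show ?thesis
  proof (intro exI[of _ B] conjI allI impI ballI)
    show "finite (B i)" for i
      using closed by (simp add: B_def)
  next
    fix L V M i
    assume series: "tableau_series k g d r C T L V"
      and avoid: "avoids k C ({1..g} - entries \<rho> r T) B L"
      and L1: "is_L1 k g r C L V M" and i: "i \<in> {1..g}"
    define Y P Q t m where "Y = cpt C i" and "P = ptP C i" and "Q = ptQ C i"
      and "t = col \<rho> r T i" and "m = int r + beta \<rho> T i t - int t - beta \<rho> T i r"
    interpret genus_one_curve k Y
      using chain i by unfold_locales (auto simp: general_elliptic_chain_def Y_def)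
    have pts: "P \<in> points k Y" "Q \<in> points k Y"
      using chain i by (auto simp: general_elliptic_chain_def Y_def P_def Q_def)
    have W: "?W i = Poly_Mapping.single P (int d - tab_u d \<rho> T r (i - 1)) +
        Poly_Mapping.single Q (tab_u d \<rho> T r i)"
      by (simp add: tab_twist_def P_def Q_def)
    have M: "lin_equiv k Y (restr M i) (L i - ?W i + fixed_part r C i)"
      using L1 i L1_cpt_eq[OF tableau[unfolded rows(2)] series i]
      unfolding is_L1_def Y_def rows(2) by metis
    \<comment> \<open>It remains, in each of the three cases, to find the class of
      \<open>L i - ?W i\<close>.\<close>
    have restr_equiv: "lin_equiv k Y (restr M i) (fixed_part r C i + E)"
      if "lin_equiv k Y (L i - ?W i) E" for E
      using M by (rule lin_equiv_trans) (rule lin_equiv_cong_diff[OF that], simp)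
    have L_entry: "lin_equiv k Y (L i) (Poly_Mapping.single P (int t + int i - beta \<rho> T i t) +
        Poly_Mapping.single Q (int d - (int t + int i - beta \<rho> T i t)))" if "i \<in> entries \<rho> r T"
      using series that i rows by (auto simp: tableau_series_def Let_def Y_def P_def Q_def t_def)

    have last_col: "lin_equiv k Y (restr M i) (fixed_part r C i)"
      if e: "i \<in> entries \<rho> r T" "t = r"
    proof -
      \<comment> \<open>Now u_r(i) = u_r(i-1), so \<open>?W i\<close> has degree \<open>d\<close>
        and is the very divisor that prescribes \<open>L i\<close>.\<close>
      have "beta \<rho> T (i - 1) r = beta \<rho> T i r - 1"
        using beta_pred_entry[OF tableau e(1)] i e(2) by (auto simp: t_def)
      then have "?W i = Poly_Mapping.single P (int t + int i - beta \<rho> T i t) +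
          Poly_Mapping.single Q (int d - (int t + int i - beta \<rho> T i t))"
        using i e(2) by (simp add: W tab_u_def of_nat_diff algebra_simps)
      with L_entry[OF e(1)] have "lin_equiv k Y (L i - ?W i) 0"
        using lin_equiv_iff_diff by metis
      from restr_equiv[OF this] show ?thesis by simp
    qed

    have inner_col: "\<exists>x \<in> points k Y.
        lin_equiv k Y (restr M i) (fixed_part r C i + Poly_Mapping.single x 1) \<and>
        lin_equiv k Y (Poly_Mapping.single x 1 + Poly_Mapping.single P (m - 1))
          (Poly_Mapping.single Q m)"
      if e: "i \<in> entries \<rho> r T" "t < r"
    proof -
      \<comment> \<open>\<open>1 - m\<close> and \<open>m\<close> are the coefficients left when
        \<open>?W i\<close> is subtracted from the divisor prescribing \<open>L i\<close>; the 1 is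
        the drop from u_r(i-1) to u_r(i).\<close>
      define D where "D = Poly_Mapping.single P (1 - m) + Poly_Mapping.single Q m"
      have "beta \<rho> T (i - 1) r = beta \<rho> T i r"
        using beta_pred_other[OF tableau] e by (auto simp: t_def)
      then have "D + ?W i = Poly_Mapping.single P (int t + int i - beta \<rho> T i t) +
          Poly_Mapping.single Q (int d - (int t + int i - beta \<rho> T i t))"
        using i by (intro poly_mapping_eqI)
          (auto simp: D_def W m_def tab_u_def lookup_add lookup_single when_def of_nat_diff)
      with L_entry[OF e(1)] have "lin_equiv k Y (L i) (D + ?W i)" by simp
      then have LD: "lin_equiv k Y (L i - ?W i) D"
        by (rule lin_equiv_cong_diff) (simp add: algebra_simps)
      have "D \<in> divisors k Y" "div_degree D = 1"
        using pts by (auto simp: D_def div_degree_add)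
      then obtain x where x: "x \<in> points k Y" "lin_equiv k Y D (Poly_Mapping.single x 1)"
        by (rule degree_one_equiv_point)
      \<comment> \<open>This is the equivalence of \<open>D\<close> and the point \<open>x\<close>,
        with the multiple of \<open>P\<close> moved to the other side.\<close>
      have "lin_equiv k Y (Poly_Mapping.single x 1 + Poly_Mapping.single P (m - 1))
          (Poly_Mapping.single Q m)"
        by (rule lin_equiv_cong_diff[OF lin_equiv_sym[OF x(2)]])
          (auto intro!: poly_mapping_eqI simp: D_def lookup_add lookup_minus lookup_single when_def)
      with restr_equiv[OF lin_equiv_trans[OF LD x(2)]] x(1) show ?thesis by blast
    qed

    have outside: "\<exists>x \<in> points k Y - Z i.
        lin_equiv k Y (restr M i) (fixed_part r C i + Poly_Mapping.single x 1)"
      if e: "i \<notin> entries \<rho> r T"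
    proof -
      have "L i \<in> divisors k Y" "div_degree (L i) = int d"
        using series i by (auto simp: tableau_series_def limit_linear_series_def Let_def Y_def)
      moreover have "beta \<rho> T (i - 1) r = beta \<rho> T i r"
        using beta_pred_other[OF tableau] e by auto
      \<comment> \<open>As u_r drops by one, \<open>?W i\<close> has degree d - 1.\<close>
      ultimately have "L i - ?W i \<in> divisors k Y" "div_degree (L i - ?W i) = 1"
        using pts i by (auto simp: W div_degree_add div_degree_diff tab_u_def of_nat_diff)
      then obtain x where x: "x \<in> points k Y" "lin_equiv k Y (L i - ?W i) (Poly_Mapping.single x 1)"
        by (rule degree_one_equiv_point)
      \<comment> \<open>Undoing the twist shows that a point \<open>x\<close> of \<open>Z i\<close>
        would put \<open>L i\<close> into an excluded class.\<close>
      have "lin_equiv k Y (L i) (Poly_Mapping.single x 1 + ?W i)"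
        using x(2) by (rule lin_equiv_cong_diff) (simp add: algebra_simps)
      then have "x \<notin> Z i"
        using avoid i e by (auto simp: avoids_def B_def Y_def)
      with restr_equiv[OF x(2)] x(1) show ?thesis by blast
    qed

    show "let Y = cpt C i; P = ptP C i; Q = ptQ C i; t = col \<rho> r T i;
            m = int r + beta \<rho> T i t - int t - beta \<rho> T i r in
        (i \<in> entries \<rho> r T \<and> t = r \<longrightarrow>
           lin_equiv k Y (restr M i) (fixed_part r C i)) \<and>
        (i \<in> entries \<rho> r T \<and> t < r \<longrightarrow>
           (\<exists>x \<in> points k Y.
              lin_equiv k Y (restr M i) (fixed_part r C i + Poly_Mapping.single x 1) \<and>
              lin_equiv k Y (Poly_Mapping.single x 1 + Poly_Mapping.single P (m - 1))
                (Poly_Mapping.single Q m))) \<and>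
        (i \<notin> entries \<rho> r T \<longrightarrow>
           (\<exists>x \<in> points k Y - Z i.
              lin_equiv k Y (restr M i) (fixed_part r C i + Poly_Mapping.single x 1)))"
      unfolding Let_def
      using last_col inner_col outside unfolding Y_def P_def Q_def t_def m_def by blast
  qed
qed

end
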